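(* Let $E,F$ be Banach spaces, $U\subset E$ open, $f:U\to F$ a $C^1$ map, and $x_0\in U$ with $f'(x_0)$ double splitting. Let $f'(x_0)$ belong to any one of the following classes: $F_k$, $\Phi_{m,n}$, $\Phi_{\infty,n}$ $(n<\infty)$ and $\Phi_{m,\infty}$ $(m<\infty)$. Then $f$ is locally conjugate to $f'(x_0)$ near $x_0$ if and only if $f'(x)$ belongs to that same class for all $x$ in some neighborhood of $x_0$.
   Context: $B(E,F)$ is the space of bounded linear operators; $N(\cdot)$, $R(\cdot)$ denote null space and range. An operator $A\in B(E,F)$ is double splitting if $R(A)$ is closed and $N(A)$ and $R(A)$ have closed complements in $E$ and $F$ respectively. $F_k=\{T\in B(E,F):\operatorname{rank}T=k\}$ with $k<\infty$; $\Phi_{m,n}$ is the set of Fredholm operators $T$ with $\dim N(T)=m<\infty$ and $\operatorname{codim}R(T)=n<\infty$; $\Phi_{m,\infty}$ is the set of semi-Fredholm operators $T$ (closed range) with $\dim N(T)=m<\infty$, $\operatorname{codim}R(T)=\infty$; $\Phi_{\infty,n}$ is the set of semi-Fredholm operators $T$ with $\dim N(T)=\infty$, $\operatorname{codim}R(T)=n<\infty$. Local conjugacy: $f$ is locally conjugate to $f'(x_0)$ near $x_0$ if there exist a neighborhood $U_0\subset U$ of $x_0$, a neighborhood $V_0\subset F$ of $0$, and ($C^1$) diffeomorphisms $\varphi:U_0\to\varphi(U_0)\subset E$ with $\varphi(x_0)=0$, $\varphi'(x_0)=I_E$, and $\psi:V_0\to\psi(V_0)\subset F$ with $\psi(0)=f(x_0)$,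 $\psi'(0)=I_F$, such that $f(x)=(\psi\circ f'(x_0)\circ\varphi)(x)$ for all $x\in U_0$ (in particular the composition is defined on $U_0$). *)

theory Defs
  imports "HOL-Analysis.Analysis"
begin

section \<open>Dimension and codimension\<close>

definition alg_complement :: "'a::real_vector set \<Rightarrow> 'a set \<Rightarrow> bool" where
  "alg_complement S C \<longleftrightarrow>
     subspace S \<and> subspace C \<and> S \<inter> C = {0} \<and> {s + c | s c. s \<in> S \<and> c \<in> C} = UNIV"

text \<open>The library's \<^term>\<open>dim\<close> is \<^term>\<open>0\<close> on infinite-dimensional
  spaces, so infinite dimension has to be kept apart.\<close>

definition edim :: "'a::real_vector set \<Rightarrow> enat" where
  "edim V = (if \<exists>B. finite B \<and> V \<subseteq> span B then enat (dim V) else \<infinity>)"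

text \<open>The dimension of the quotient by \<^term>\<open>S\<close>, computed on an algebraic
  complement of \<^term>\<open>S\<close>. A complement exists by \<open>alg_complement_exists\<close>, and
  the choice is immaterial by \<open>ecodim_eq\<close>.\<close>

definition ecodim :: "'a::real_vector set \<Rightarrow> enat" where
  "ecodim S = edim (SOME C. alg_complement S C)"

lemma alg_complement_exists:
  fixes S :: "'a::real_vector set"
  assumes S: "subspace S"
  shows "\<exists>C. alg_complement S C"
proof -
  obtain g :: "'a \<Rightarrow> 'a" where g: "range g \<subseteq> S" "linear g" "\<And>v. v \<in> S \<Longrightarrow> g v = v"
    using linear_exists_left_inverse_on[OF linear_ident S] by auto
  have gd: "g (x - g x) = 0" for x
    using g by (simp add: linear_diff image_subset_iff)
  have "x \<in> {s + c | s c. s \<in> S \<and> c \<in> {x. g x = 0}}" for x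
    unfolding mem_Collect_eq using gd[of x] g(1)
    by (intro exI[of _ "g x"] exI[of _ "x - g x"]) (simp add: image_subset_iff)
  moreover have "S \<inter> {x. g x = 0} = {0}"
    using g S by (auto simp: subspace_0 linear_0)
  moreover have "subspace {x. g x = 0}"
    using g(2) by (rule linear_subspace_kernel)
  ultimately have "alg_complement S {x. g x = 0}"
    unfolding alg_complement_def using S by blast
  then show ?thesis ..
qed

lemma edim_eq_if_linear_bij:
  assumes "linear p" "inj_on p C" "p ` C = D" "subspace C"
  shows "edim C = edim D"
proof -
  obtain B where B: "B \<subseteq> C" "independent B" "C \<subseteq> span B" "card B = dim C"
    using basis_exists by blast
  have sB: "span B = C"
    using B assms(4) by (simp add: span_minimal subset_antisym)
  have inj: "inj_on p (span B)" using assms(2) sB by simp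
  have iB: "independent (p ` B)"
    using linear_independent_injective_image[OF assms(1) B(2) inj] .
  have spB: "span (p ` B) = D"
    using linear_span_image[OF assms(1), of B] sB assms(3) by simp
  have injB: "inj_on p B" using assms(2) B(1) inj_on_subset by blast
  have fin: "(\<exists>A. finite A \<and> span X \<subseteq> span A) \<longleftrightarrow> finite X"
    if "independent X" for X :: "'c::real_vector set"
  proof
    assume "\<exists>A. finite A \<and> span X \<subseteq> span A"
    then obtain A where "finite A" "X \<subseteq> span A" using span_superset by blast
    then show "finite X" using independent_span_bound that by blast
  qed blast
  have "dim D = card (p ` B)"
    using dim_span_eq_card_independent[OF iB] spB by simp
  also have "\<dots> = dim C" using card_image[OF injB] B(4) by simp
  finally show ?thesis
    using fin[OF B(2)] fin[OF iB] finite_image_iff[OF injB] unfolding edim_def sB spB by simp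
qed

lemma ecodim_eq:
  assumes "alg_complement S C"
  shows "ecodim S = edim C"
proof -
  define D where "D = (SOME C. alg_complement S C)"
  have D: "alg_complement S D" unfolding D_def using assms by (rule someI)
  have sub: "subspace S" "subspace C" "subspace D"
    and C0: "S \<inter> C = {0}" and D0: "S \<inter> D = {0}"
    and Cs: "{s + c | s c. s \<in> S \<and> c \<in> C} = UNIV"
    and Ds: "{s + c | s c. s \<in> S \<and> c \<in> D} = UNIV"
    using assms D unfolding alg_complement_def by auto
  have "\<forall>x. \<exists>d. d \<in> D \<and> x - d \<in> S"
  proof
    fix x
    have "x \<in> {s + c | s c. s \<in> S \<and> c \<in> D}" using Ds by simp
    then obtain s d where "x = s + d" "s \<in> S" "d \<in> D" by blast
    then show "\<exists>d. d \<in> D \<and> x - d \<in> S" by (intro exI[of _ d]) simp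
  qed
  then obtain p where p: "\<And>x. p x \<in> D" "\<And>x. x - p x \<in> S" by metis
  have uniq: "p x = d" if "d \<in> D" "x - d \<in> S" for x d
  proof -
    have "p x - d \<in> D" using p that sub by (simp add: subspace_diff)
    moreover have "(x - d) - (x - p x) \<in> S" using p that sub subspace_diff by blast
    hence "p x - d \<in> S" by (simp add: algebra_simps)
    ultimately have "p x - d \<in> S \<inter> D" by (rule IntI[rotated])
    then show ?thesis unfolding D0 by simp
  qed
  have lin: "linear p"
  proof (rule linearI)
    fix x y
    have "(x - p x) + (y - p y) \<in> S" using p sub subspace_add by blast
    then show "p (x + y) = p x + p y"
      by (intro uniq) (simp_all add: p sub subspace_add add_diff_add)
  next
    fix r x
    have "r *\<^sub>R (x - p x) \<in> S" using p sub subspace_scale by blast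
    then show "p (r *\<^sub>R x) = r *\<^sub>R p x"
      by (intro uniq) (simp_all add: p sub subspace_scale scaleR_diff_right)
  qed
  have inj: "inj_on p C"
  proof (rule inj_onI)
    fix x y assume xy: "x \<in> C" "y \<in> C" "p x = p y"
    have "(x - p x) - (y - p y) \<in> S" using p sub subspace_diff by blast
    hence "x - y \<in> S" using xy by simp
    moreover have "x - y \<in> C" using xy sub by (simp add: subspace_diff)
    ultimately have "x - y \<in> S \<inter> C" by (rule IntI)
    then show "x = y" unfolding C0 by simp
  qed
  have "p ` C = D"
  proof
    show "D \<subseteq> p ` C"
    proof
      fix d assume d: "d \<in> D"
      have "d \<in> {s + c | s c. s \<in> S \<and> c \<in> C}" using Cs by simp
      then obtain s c where sc: "d = s + c" "s \<in> S" "c \<in> C" by blast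
      have "c - d = - s" using sc by simp
      then have "p c = d" using d sc sub by (intro uniq) (simp_all add: subspace_neg)
      then show "d \<in> p ` C" using sc by blast
    qed
  qed (use p in auto)
  from edim_eq_if_linear_bij[OF lin inj this sub(2)] show ?thesis
    unfolding ecodim_def D_def by simp
qed

section \<open>Classes of bounded operators\<close>

abbreviation null_space :: "'a::real_normed_vector \<Rightarrow>\<^sub>L 'b::real_normed_vector \<Rightarrow> 'a set" where
  "null_space T \<equiv> {x. blinfun_apply T x = 0}"

abbreviation range_space :: "'a::real_normed_vector \<Rightarrow>\<^sub>L 'b::real_normed_vector \<Rightarrow> 'b set" where
  "range_space T \<equiv> range (blinfun_apply T)"

definition double_splitting :: "'a::real_normed_vector \<Rightarrow>\<^sub>L 'b::real_normed_vector \<Rightarrow> bool" where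
  "double_splitting T \<longleftrightarrow> closed (range_space T)
     \<and> (\<exists>C. closed C \<and> alg_complement (null_space T) C)
     \<and> (\<exists>C. closed C \<and> alg_complement (range_space T) C)"

definition rank_class :: "nat \<Rightarrow> ('a::real_normed_vector \<Rightarrow>\<^sub>L 'b::real_normed_vector) set" where
  "rank_class k = {T. edim (range_space T) = enat k}"

definition semi_Fredholm :: "'a::real_normed_vector \<Rightarrow>\<^sub>L 'b::real_normed_vector \<Rightarrow> bool" where
  "semi_Fredholm T \<longleftrightarrow> closed (range_space T)
     \<and> (edim (null_space T) < \<infinity> \<or> ecodim (range_space T) < \<infinity>)"

text \<open>For finite \<^term>\<open>m\<close> and \<^term>\<open>n\<close> these are the Fredholm operators with
  nullity \<^term>\<open>m\<close> and deficiency \<^term>\<open>n\<close>.\<close>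

definition Phi_class ::
    "enat \<Rightarrow> enat \<Rightarrow> ('a::real_normed_vector \<Rightarrow>\<^sub>L 'b::real_normed_vector) set" where
  "Phi_class m n = {T. semi_Fredholm T \<and> edim (null_space T) = m \<and> ecodim (range_space T) = n}"

section \<open>Maps of class C1 and local conjugacy\<close>

text \<open>Only used for open \<^term>\<open>S\<close>; continuity of \<^term>\<open>f'\<close> refers to the operator norm.\<close>

definition C1_on ::
    "'a::real_normed_vector set \<Rightarrow> ('a \<Rightarrow> 'b::real_normed_vector) \<Rightarrow> ('a \<Rightarrow> 'a \<Rightarrow>\<^sub>L 'b) \<Rightarrow> bool" where
  "C1_on S f f' \<longleftrightarrow>
     (\<forall>x\<in>S. (f has_derivative blinfun_apply (f' x)) (at x)) \<and> continuous_on S f'"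

definition C1_diffeo_on ::
    "'a::real_normed_vector set \<Rightarrow> ('a \<Rightarrow> 'b::real_normed_vector) \<Rightarrow> bool" where
  "C1_diffeo_on S f \<longleftrightarrow> open S \<and> open (f ` S) \<and> (\<exists>f'. C1_on S f f')
     \<and> (\<exists>g g'. (\<forall>x\<in>S. g (f x) = x) \<and> C1_on (f ` S) g g')"

text \<open>\<^term>\<open>A\<close> stands for the derivative of \<^term>\<open>f\<close> at \<^term>\<open>x\<^sub>0\<close>.\<close>

definition locally_conjugate ::
    "'a::real_normed_vector set \<Rightarrow> ('a \<Rightarrow> 'b::real_normed_vector) \<Rightarrow> 'a \<Rightarrow> ('a \<Rightarrow>\<^sub>L 'b) \<Rightarrow> bool" where
  "locally_conjugate U f x\<^sub>0 A \<longleftrightarrow>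
     (\<exists>U\<^sub>0 V\<^sub>0 \<phi> \<psi>. U\<^sub>0 \<subseteq> U \<and> x\<^sub>0 \<in> U\<^sub>0 \<and> 0 \<in> V\<^sub>0
        \<and> C1_diffeo_on U\<^sub>0 \<phi> \<and> \<phi> x\<^sub>0 = 0 \<and> (\<phi> has_derivative (\<lambda>h. h)) (at x\<^sub>0)
        \<and> C1_diffeo_on V\<^sub>0 \<psi> \<and> \<psi> 0 = f x\<^sub>0 \<and> (\<psi> has_derivative (\<lambda>h. h)) (at 0)
        \<and> (\<forall>x\<in>U\<^sub>0. blinfun_apply A (\<phi> x) \<in> V\<^sub>0 \<and> f x = \<psi> (blinfun_apply A (\<phi> x))))"

end

theory Submission
  imports Defs
begin

text \<open>
  Let \<open>A = f' x\<^sub>0\<close>. By the closed graph theorem, double splitting yields a bounded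
  \<open>G\<close> with \<open>A G A = A\<close> and \<open>G A G = G\<close>, so that \<open>null_space G\<close> is a complement of
  the range of \<open>A\<close>. For \<open>T\<close> near \<open>A\<close> in the same class, counting dimensions
  (of the range, the kernel or a complement of the range, whichever is finite) gives the
  transversality \<open>range_space T \<inter> null_space G = {0}\<close>.

  The map \<open>\<phi> x = G (f x - f x\<^sub>0) + (x - x\<^sub>0) - G (A (x - x\<^sub>0))\<close> has derivative the identity
  at \<open>x\<^sub>0\<close>, so it has a local inverse \<open>g\<close>, and \<open>A G (f (g y) - f x\<^sub>0) = A y\<close>. Transversality
  makes the derivative of \<open>f \<circ> g\<close> vanish on the kernel of \<open>A\<close>, hence \<open>f (g y)\<close> depends only on
  \<open>G (A y)\<close>. The part of \<open>f\<close> in \<open>null_space G\<close> is therefore a function of \<open>A (\<phi> x)\<close>, which is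
  absorbed by the shear \<open>\<psi> z = f x\<^sub>0 + z + (1 - A G) (f (g (G z)) - f x\<^sub>0)\<close>.
  Conversely, conjugacy writes each \<open>f' x\<close> as \<open>Q A P\<close> with invertible \<open>P\<close> and \<open>Q\<close>, and the
  classes are invariant under this.
\<close>

section \<open>Dimension counting and the closed graph theorem\<close>

text \<open>A vector of \<open>T\<close> outside \<open>S\<close> would extend a basis of
  \<open>S\<close> to \<open>m + 1\<close> independent vectors in a space of dimension
  \<open>m\<close>. Finiteness of the common dimension is essential here.\<close>

lemma subspace_eq_if_edim_eq:
  assumes "subspace S" "subspace T" "S \<subseteq> T" "edim S = enat m" "edim T = enat m"
  shows "S = T"
proof -
  obtain A where A: "finite A" "T \<subseteq> span A" and dT: "dim T = m"
    using assms(5) by (auto simp: edim_def split: if_splits)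
  have dS: "dim S = m" using assms(4) by (auto simp: edim_def split: if_splits)
  obtain B where B: "B \<subseteq> S" "independent B" "S \<subseteq> span B" "card B = dim S"
    using basis_exists by blast
  have sB: "span B = S" using B assms(1) by (simp add: span_minimal subset_antisym)
  have "x \<in> span B" if "x \<in> T" for x
  proof (rule ccontr)
    assume x: "x \<notin> span B"
    then have ind: "independent (insert x B)" using B(2) by (simp add: independent_insertI)
    have sub: "insert x B \<subseteq> T" using that B(1) assms(3) by blast
    obtain D where D: "insert x B \<subseteq> D" "D \<subseteq> T" "independent D" "T \<subseteq> span D"
      using maximal_independent_subset_extend[OF sub ind] by blast
    have "finite D" using independent_span_bound[OF A(1) D(3)] D(2) A(2) by blast
    have "card D = m" using basis_card_eq_dim[OF D(2) D(4) D(3)] dT by simp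
    moreover have "card (insert x B) \<le> card D" using D(1) \<open>finite D\<close> by (rule card_mono[rotated])
    moreover have "card (insert x B) = Suc (card B)"
      using x span_base D(1) \<open>finite D\<close> finite_subset by (intro card_insert_disjoint) auto
    ultimately show False using B(4) dS by simp
  qed
  then show ?thesis using sB assms(3) by blast
qed

text \<open>A basis of \<open>C\<close> is mapped to a spanning set of the image. Since the image
  still has dimension \<open>k\<close>, no basis vector can be lost, so the images are distinct and
  independent.\<close>

lemma inj_on_if_edim_image_eq:
  assumes p: "linear p" and C: "subspace C" and "edim C = enat k" "edim (p ` C) = enat k"
  shows "inj_on p C"
proof -
  obtain A where A: "finite A" "C \<subseteq> span A" and dC: "dim C = k"
    using assms(3) by (auto simp: edim_def split: if_splits)
  have dpC: "dim (p ` C) = k" using assms(4) by (auto simp: edim_def split: if_splits)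
  obtain B where B: "B \<subseteq> C" "independent B" "C \<subseteq> span B" "card B = dim C"
    using basis_exists by blast
  have sB: "span B = C" using B C by (simp add: span_minimal subset_antisym)
  have fB: "finite B" using independent_span_bound[OF A(1) B(2)] B(1) A(2) by blast
  have sp: "span (p ` B) = p ` C" using linear_span_image[OF p, of B] sB by simp
  obtain D where D: "D \<subseteq> p ` B" "independent D" "p ` B \<subseteq> span D" "card D = dim (p ` B)"
    using basis_exists by blast
  have "card D = k" using D(4) sp dpC by (metis dim_span)
  have le: "card (p ` B) \<le> card B" using fB by (rule card_image_le)
  have "card D \<le> card (p ` B)" using D(1) fB by (simp add: card_mono)
  then have eq: "card (p ` B) = card B" "card D = card (p ` B)"
    using le \<open>card D = k\<close> B(4) dC by auto
  then have "D = p ` B" using D(1) fB by (simp add: card_subset_eq)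
  then have "independent (p ` B)" using D(2) by simp
  moreover have "inj_on p B" using eq(1) fB by (simp add: eq_card_imp_inj_on)
  ultimately show ?thesis
    using linear_inj_on_span_iff_independent_image[OF p, of B]
      linear_inj_on_span_independent_image[OF p, of B] sB by simp
qed

section \<open>The closed graph theorem\<close>

text \<open>By Baire, the closure of some sublevel set of \<open>norm (L x)\<close> contains a ball,
  so every vector is approximated by vectors with controlled image. Repeated correction of the error
  writes \<open>x\<close> as a series whose images converge absolutely, and closedness of the graph
  identifies their sum with \<open>L x\<close>.\<close>

lemma closed_graph:
  fixes L :: "'a::banach \<Rightarrow> 'b::banach"
  assumes lin: "linear L" and cl: "closed {(x, L x) |x. True}"
  shows "bounded_linear L"
proof -
  let ?K = "\<lambda>n. closure {x. norm (L x) \<le> real n}"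
  have "\<exists>n. interior (?K n) \<noteq> {}"
  proof (rule ccontr)
    assume "\<nexists>n. interior (?K n) \<noteq> {}"
    then have "euclidean interior_of (\<Union>(range ?K)) = {}"
      using completely_metrizable_space_euclidean
      by (intro Baire_category_alt) (auto simp: interior_of_def interior_def)
    moreover have "(\<Union>(range ?K)) = UNIV"
    proof -
      have "x \<in> (\<Union>(range ?K))" for x
      proof -
        obtain n where "norm (L x) \<le> real n" using real_arch_simple by blast
        then have "x \<in> ?K n" by (intro subsetD[OF closure_subset]) simp
        then show ?thesis by blast
      qed
      then show ?thesis by blast
    qed
    ultimately show False using interior_of_topspace[of "euclidean :: 'a topology"] by simp
  qed
  then obtain n a r where r: "r > 0" "ball a r \<subseteq> ?K n"
    using mem_interior by blast
  \<comment> \<open>Recentring at the origin: \<open>x\<close> is half the difference of \<open>a + x\<close> and \<open>a - x\<close>.\<close>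
  have approx0: "\<exists>u. norm (L u) \<le> real n \<and> norm (x - u) < e" if "norm x < r" "e > 0" for x e
  proof -
    have "a + x \<in> ?K n" "a - x \<in> ?K n" using r(2) that(1) by (auto simp: dist_norm)
    then obtain u v where u: "norm (L u) \<le> n" "dist u (a + x) < e"
      and v: "norm (L v) \<le> n" "dist v (a - x) < e"
      using \<open>e > 0\<close> unfolding closure_approachable by blast
    let ?w = "(1/2) *\<^sub>R (u - v)"
    have "L ?w = (1/2) *\<^sub>R (L u - L v)" using lin by (simp add: linear_diff linear_scale)
    then have "norm (L ?w) \<le> n" using u(1) v(1) norm_triangle_ineq4[of "L u" "L v"] by simp
    moreover have "x - ?w = (1/2) *\<^sub>R ((a + x - u) - (a - x - v))"
      by (simp add: algebra_simps flip: scaleR_add_left)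
    then have "norm (x - ?w) < e"
      using u(2) v(2) norm_triangle_ineq4[of "a + x - u" "a - x - v"]
      by (simp add: dist_norm norm_minus_commute)
    ultimately show ?thesis by blast
  qed
  \<comment> \<open>Scaling by \<open>t = r / (2 * d)\<close> brings \<open>x\<close> to norm at
    most \<open>r / 2\<close>, strictly inside the ball of \<open>approx0\<close>; scaling back
    turns the bound \<open>n\<close> into \<open>n / t = M * d\<close>.\<close>
  define M where "M = real n / r * 2"
  have approx: "\<exists>u. norm (L u) \<le> M * d \<and> norm (x - u) \<le> d / 2" if "norm x \<le> d" "d > 0" for x d
  proof -
    define t where "t = r / (2 * d)"
    have t: "t > 0" using r that by (simp add: t_def)
    have "norm (t *\<^sub>R x) \<le> r / 2" using that r(1) by (simp add: t_def field_simps)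
    then have "norm (t *\<^sub>R x) < r" using r(1) by linarith
    then obtain u where u: "norm (L u) \<le> n" "norm (t *\<^sub>R x - u) < t * d / 2"
      using approx0[of "t *\<^sub>R x" "t * d / 2"] t \<open>d > 0\<close> mult_pos_pos[OF t \<open>d > 0\<close>] by auto
    let ?u = "(1/t) *\<^sub>R u"
    have "norm (L ?u) = norm (L u) / t" using lin t by (simp add: linear_scale)
    also have "\<dots> \<le> n / t" using u(1) t by (simp add: divide_right_mono)
    also have "\<dots> = M * d" using r that by (simp add: t_def M_def)
    finally have 1: "norm (L ?u) \<le> M * d" .
    have "x - ?u = (1/t) *\<^sub>R (t *\<^sub>R x - u)" using t by (simp add: scaleR_diff_right)
    then have "norm (x - ?u) = norm (t *\<^sub>R x - u) / t" using t by simp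
    also have "\<dots> \<le> d / 2" using u(2) t by (simp add: field_simps)
    finally show ?thesis using 1 by blast
  qed
  have bound: "norm (L x) \<le> 2 * M * d" if x: "norm x \<le> d" and d: "d > 0" for x d
  proof -
    obtain U where U: "\<And>y e. norm y \<le> e \<Longrightarrow> e > 0 \<Longrightarrow>
        norm (L (U y e)) \<le> M * e \<and> norm (y - U y e) \<le> e / 2"
      using approx by metis
    \<comment> \<open>\<open>R k\<close> is the error left after \<open>k\<close> corrections; it
      halves at each step, so the images of the corrections are dominated by a geometric series with
      sum \<open>2 * M * d\<close>.\<close>
    define R where "R = rec_nat x (\<lambda>k y. y - U y (d / 2 ^ k))"
    define u where "u = (\<lambda>k. U (R k) (d / 2 ^ k))"
    have R: "R 0 = x" "R (Suc k) = R k - u k" for k by (simp_all add: R_def u_def)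
    have Rn: "norm (R k) \<le> d / 2 ^ k" for k
    proof (induction k)
      case (Suc k)
      then show ?case using U[OF Suc] d by (simp add: R u_def)
    qed (use x R in simp)
    have Lu: "norm (L (u k)) \<le> M * d * (1/2) ^ k" for k
      using U[OF Rn[of k]] d by (simp add: u_def power_divide)
    have sums: "(\<lambda>k. M * d * (1/2) ^ k) sums (2 * M * d)"
      using sums_mult[OF geometric_sums[of "1/2::real"], of "M * d"] by (simp add: mult_ac)
    have ab: "summable (\<lambda>k. norm (L (u k)))"
      using Lu sums by (intro summable_comparison_test'[OF sums_summable[OF sums]]) auto
    then have s: "summable (\<lambda>k. L (u k))" by (rule summable_norm_cancel)
    have partial: "(\<Sum>j<k. u j) = x - R k" for k by (induction k) (auto simp: R)
    have "(\<lambda>k. d * (1/2) ^ k) \<longlonglongrightarrow> d * 0"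
      by (intro tendsto_mult_left LIMSEQ_power_zero) simp
    then have "R \<longlonglongrightarrow> 0"
      using Rn by (intro Lim_null_comparison[of R "\<lambda>k. d * (1/2) ^ k"]) (auto simp: power_divide)
    then have "(\<lambda>k. x - R k) \<longlonglongrightarrow> x - 0" by (intro tendsto_diff tendsto_const)
    then have 1: "(\<lambda>k. \<Sum>j<k. u j) \<longlonglongrightarrow> x" unfolding partial by simp
    have "(\<lambda>k. L (\<Sum>j<k. u j)) \<longlonglongrightarrow> (\<Sum>k. L (u k))"
      using summable_LIMSEQ[OF s] by (simp add: linear_sum[OF lin])
    from closed_sequentially[OF cl _ tendsto_Pair[OF 1 this]]
    have "L x = (\<Sum>k. L (u k))" by auto
    also have "norm \<dots> \<le> (\<Sum>k. norm (L (u k)))" using ab by (rule summable_norm)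
    also have "\<dots> \<le> (\<Sum>k. M * d * (1/2) ^ k)"
      using Lu ab sums_summable[OF sums] by (rule suminf_le)
    also have "\<dots> = 2 * M * d" using sums by (rule sums_unique[symmetric])
    finally show ?thesis .
  qed
  show ?thesis
  proof (rule bounded_linear_intro[where K = "2 * M"])
    show "norm (L x) \<le> norm x * (2 * M)" for x
      using bound[of x "norm x"] lin by (cases "x = 0") (auto simp: linear_0 mult_ac)
  qed (use lin in \<open>auto simp: linear_add linear_scale\<close>)
qed

section \<open>The inverse function theorem at an identity derivative\<close>

lemma C1_on_imp_continuous_on: "C1_on S f f' \<Longrightarrow> continuous_on S f"
  unfolding C1_on_def
  by (meson continuous_at_imp_continuous_on has_derivative_continuous)

lemma C1_on_subset: "C1_on S f f' \<Longrightarrow> T \<subseteq> S \<Longrightarrow> C1_on T f f'"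
  unfolding C1_on_def using continuous_on_subset by blast

lemma C1_on_blinfun: "C1_on S (blinfun_apply A) (\<lambda>_. A)"
  unfolding C1_on_def by (auto intro: bounded_linear_imp_has_derivative blinfun.bounded_linear_right)

lemma C1_on_ident: "C1_on S (\<lambda>x. x) (\<lambda>_. id_blinfun)"
  unfolding C1_on_def by (auto simp: has_derivative_ident id_blinfun.rep_eq)

lemma C1_on_const: "C1_on S (\<lambda>x. c) (\<lambda>_. 0)"
  unfolding C1_on_def by (auto simp: zero_blinfun.rep_eq)

lemma C1_on_add:
  "C1_on S f f' \<Longrightarrow> C1_on S g g' \<Longrightarrow> C1_on S (\<lambda>x. f x + g x) (\<lambda>x. f' x + g' x)"
  unfolding C1_on_def by (auto simp: plus_blinfun.rep_eq intro!: has_derivative_add continuous_on_add)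

lemma C1_on_diff:
  "C1_on S f f' \<Longrightarrow> C1_on S g g' \<Longrightarrow> C1_on S (\<lambda>x. f x - g x) (\<lambda>x. f' x - g' x)"
  unfolding C1_on_def by (auto simp: minus_blinfun.rep_eq intro!: has_derivative_diff continuous_on_diff)

lemma C1_on_compose:
  assumes f: "C1_on S f f'" and g: "C1_on T g g'" and "f ` S \<subseteq> T"
  shows "C1_on S (\<lambda>x. g (f x)) (\<lambda>x. g' (f x) o\<^sub>L f' x)"
  unfolding C1_on_def
proof (intro conjI ballI)
  fix x assume "x \<in> S"
  then have "(f has_derivative f' x) (at x)" "(g has_derivative g' (f x)) (at (f x))"
    using assms by (auto simp: C1_on_def)
  from diff_chain_at[OF this]
  show "((\<lambda>x. g (f x)) has_derivative blinfun_apply (g' (f x) o\<^sub>L f' x)) (at x)"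
    by (simp add: blinfun_compose.rep_eq o_def)
next
  have "continuous_on S f'" "continuous_on T g'" using f g by (auto simp: C1_on_def)
  then show "continuous_on S (\<lambda>x. g' (f x) o\<^sub>L f' x)"
    using C1_on_imp_continuous_on[OF f] assms(3)
    by (intro bounded_bilinear.continuous_on[OF bounded_bilinear_blinfun_compose])
      (auto intro: continuous_on_compose2)
qed

lemma C1_on_linear_compose:
  "C1_on S f f' \<Longrightarrow> C1_on S (\<lambda>x. blinfun_apply A (f x)) (\<lambda>x. A o\<^sub>L f' x)"
  using C1_on_compose[OF _ C1_on_blinfun subset_UNIV] .

lemma C1_diffeo_on_subset:
  assumes "C1_diffeo_on S f" "open T" "T \<subseteq> S"
  shows "C1_diffeo_on T f"
proof -
  obtain f' g g' where f: "C1_on S f f'" and op: "open S" "open (f ` S)"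
    and gf: "\<And>x. x \<in> S \<Longrightarrow> g (f x) = x" and g: "C1_on (f ` S) g g'"
    using assms(1) unfolding C1_diffeo_on_def by blast
  \<comment> \<open>The image of \<open>T\<close> is the preimage of \<open>T\<close> under the
    continuous inverse, hence open.\<close>
  have "f ` T = f ` S \<inter> g -` T" using gf assms(3) by force
  then have "open (f ` T)"
    using C1_on_imp_continuous_on[OF g] op(2) assms(2) by (simp add: continuous_open_preimage)
  moreover have "C1_on (f ` T) g g'" using g assms(3) by (intro C1_on_subset[OF g]) auto
  ultimately show ?thesis
    unfolding C1_diffeo_on_def using assms(2,3) C1_on_subset[OF f assms(3)] gf by blast
qed

section \<open>Inversion near the identity\<close>

text \<open>Solving \<open>u x = w\<close> amounts to finding a fixed point of
  \<open>w - (u x - x)\<close>. This is a contraction with factor 1/2, and it maps the ball of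
  radius \<open>r\<close> into itself because \<open>w\<close> is within \<open>r / 2\<close> of
  \<open>u a\<close>.\<close>

lemma surj_on_cball_if_near_identity:
  fixes u :: "'a::banach \<Rightarrow> 'a"
  assumes "0 \<le> r"
    and lip: "\<And>x y. x \<in> cball a r \<Longrightarrow> y \<in> cball a r \<Longrightarrow>
      norm ((u x - x) - (u y - y)) \<le> norm (x - y) / 2"
  shows "cball (u a) (r / 2) \<subseteq> u ` cball a r"
proof
  fix w assume w: "w \<in> cball (u a) (r / 2)"
  define T where "T x = w - (u x - x)" for x
  have "T x \<in> cball a r" if x: "x \<in> cball a r" for x
  proof -
    have "norm (T x - a) = norm ((w - u a) - ((u x - x) - (u a - a)))"
      by (simp add: T_def algebra_simps)
    also have "\<dots> \<le> norm (w - u a) + norm (x - a) / 2"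
      using norm_triangle_ineq4 lip[OF x, of a] \<open>0 \<le> r\<close> by (smt (verit) centre_in_cball)
    also have "\<dots> \<le> r" using w x by (simp add: dist_norm norm_minus_commute)
    finally show ?thesis by (simp add: dist_norm norm_minus_commute)
  qed
  moreover have "dist (T x) (T y) \<le> 1/2 * dist x y" if "x \<in> cball a r" "y \<in> cball a r" for x y
  proof -
    have "T x - T y = - ((u x - x) - (u y - y))" by (simp add: T_def)
    then show ?thesis using lip[OF that] by (simp add: dist_norm del: minus_diff_eq)
  qed
  ultimately have "\<exists>!x. x \<in> cball a r \<and> T x = x"
    using \<open>0 \<le> r\<close> complete_eq_closed[of "cball a r"] by (intro Banach_fix[where c = "1/2"]) auto
  then obtain x where "x \<in> cball a r" "T x = x" by blast
  then show "w \<in> u ` cball a r" by (intro image_eqI[of _ _ x]) (simp_all add: T_def algebra_simps)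
qed

lemma blinfun_bij_if_inverse:
  assumes "A o\<^sub>L B = id_blinfun" "B o\<^sub>L A = id_blinfun"
  shows "bij (blinfun_apply A)"
proof (rule o_bij)
  show "blinfun_apply B \<circ> blinfun_apply A = id" "blinfun_apply A \<circ> blinfun_apply B = id"
    using assms by (metis blinfun_compose.rep_eq eq_id_iff id_blinfun.rep_eq)+
qed

text \<open>The triangle inequality gives \<open>norm x \<le> 2 * norm (A x)\<close>, hence
  injectivity and the bound on the inverse; surjectivity comes from the fixed-point argument. The
  uniform bound 2 later controls how the inverse varies with the operator.\<close>

lemma inverse_near_identity:
  fixes A :: "'a::banach \<Rightarrow>\<^sub>L 'a"
  assumes A: "norm (A - id_blinfun) \<le> 1 / 2"
  obtains B where "A o\<^sub>L B = id_blinfun" "B o\<^sub>L A = id_blinfun" "norm B \<le> 2"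
proof -
  have near: "norm (A x - x) \<le> norm x / 2" for x
    using norm_blinfun[of "A - id_blinfun" x] mult_right_mono[OF A norm_ge_zero[of x]]
    by (simp add: blinfun.diff_left)
  have lower: "norm x \<le> 2 * norm (A x)" for x
    using near[of x] norm_triangle_ineq4[of "A x" "A x - x"] by simp
  have surj: "y \<in> range (blinfun_apply A)" for y
  proof -
    \<comment> \<open>The radius is chosen so that \<open>y\<close> lies in the half-radius ball
      around \<open>A 0 = 0\<close>.\<close>
    have "cball (A 0) (2 * norm y / 2) \<subseteq> blinfun_apply A ` cball 0 (2 * norm y)"
    proof (rule surj_on_cball_if_near_identity)
      show "norm ((A x - x) - (A z - z)) \<le> norm (x - z) / 2" for x z
        using near[of "x - z"] by (simp add: blinfun.diff_right algebra_simps)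
    qed simp
    then show ?thesis by (auto simp: blinfun.zero_right)
  qed
  have inj: "inj (blinfun_apply A)"
  proof (rule injI)
    fix x y assume "A x = A y"
    then show "x = y" using lower[of "x - y"] by (simp add: blinfun.diff_right)
  qed
  define b where "b = inv (blinfun_apply A)"
  have Ab: "A (b y) = y" for y using surj by (simp add: b_def f_inv_into_f)
  have bA: "b (A x) = x" for x using inj by (simp add: b_def)
  have bl: "bounded_linear b"
  proof (rule bounded_linear_intro[where K = 2])
    show "b (x + y) = b x + b y" for x y
      by (rule injD[OF inj]) (simp add: Ab blinfun.add_right)
    show "b (r *\<^sub>R x) = r *\<^sub>R b x" for r x
      by (rule injD[OF inj]) (simp add: Ab blinfun.scaleR_right)
    show "norm (b x) \<le> norm x * 2" for x using lower[of "b x"] by (simp add: Ab)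
  qed
  show ?thesis
  proof
    show "A o\<^sub>L Blinfun b = id_blinfun" "Blinfun b o\<^sub>L A = id_blinfun"
      by (auto intro!: blinfun_eqI simp: bounded_linear_Blinfun_apply[OF bl] Ab bA)
    show "norm (Blinfun b) \<le> 2"
    proof (rule norm_blinfun_bound)
      fix x show "norm (Blinfun b x) \<le> 2 * norm x"
        using lower[of "b x"] by (simp add: bounded_linear_Blinfun_apply[OF bl] Ab)
    qed simp
  qed
qed

text \<open>On a small ball \<open>f'\<close> stays within 1/2 of the identity, so by the mean value
  inequality \<open>f\<close> minus the identity is Lipschitz with constant 1/2. This yields
  injectivity, openness of the image and a Lipschitz inverse, whose derivative is the inverse
  operator.\<close>

lemma C1_diffeo_at_identity_derivative:
  fixes f :: "'a::banach \<Rightarrow> 'a"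
  assumes U: "open U" "a \<in> U" and f: "C1_on U f f'" and "f' a = id_blinfun"
  obtains S where "open S" "a \<in> S" "S \<subseteq> U" "C1_diffeo_on S f"
proof -
  have "continuous (at a) f'"
    using f U by (auto simp: C1_on_def continuous_on_eq_continuous_at)
  then have "\<forall>\<^sub>F x in at a. dist (f' x) id_blinfun < 1/2"
    using tendstoD[of f' "f' a" "at a" "1/2"] assms(4) by (simp add: continuous_at)
  then obtain d where d: "d > 0" "\<And>x. x \<noteq> a \<Longrightarrow> dist x a < d \<Longrightarrow> dist (f' x) id_blinfun < 1/2"
    unfolding eventually_at by auto
  obtain e where e: "e > 0" "ball a e \<subseteq> U" using U openE by blast
  define S where "S = ball a (min d e)"
  have S: "open S" "a \<in> S" "S \<subseteq> U" "convex S" using d e by (auto simp: S_def)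
  have near: "norm (f' x - id_blinfun) \<le> 1/2" if "x \<in> S" for x
    using that d(2)[of x] assms(4) by (cases "x = a") (auto simp: S_def dist_norm norm_minus_commute)
  have fS: "C1_on S f f'" using f S(3) by (rule C1_on_subset)
  have lip: "norm ((f x - x) - (f y - y)) \<le> norm (x - y) / 2" if "x \<in> S" "y \<in> S" for x y
  proof -
    have "C1_on S (\<lambda>x. f x - x) (\<lambda>x. f' x - id_blinfun)"
      using fS C1_on_ident by (rule C1_on_diff)
    then have "norm ((f x - x) - (f y - y)) \<le> 1/2 * norm (x - y)"
      using that near
      by (intro differentiable_bound[OF S(4), where f' = "\<lambda>x. blinfun_apply (f' x - id_blinfun)"])
        (auto simp: C1_on_def norm_blinfun.rep_eq[symmetric] intro: has_derivative_at_withinI)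
    then show ?thesis by simp
  qed
  have lower: "norm (x - y) \<le> 2 * norm (f x - f y)" if "x \<in> S" "y \<in> S" for x y
    using lip[OF that] norm_triangle_ineq4[of "f x - f y" "(f x - x) - (f y - y)"] by simp
  have inj: "inj_on f S"
  proof (rule inj_onI)
    fix x y assume "x \<in> S" "y \<in> S" "f x = f y"
    then show "x = y" using lower[of x y] by simp
  qed
  have op: "open (f ` S)"
    unfolding open_contains_cball
  proof (intro ballI)
    fix w assume "w \<in> f ` S"
    then obtain x where x: "x \<in> S" "w = f x" by blast
    obtain s where s: "s > 0" "cball x s \<subseteq> S" using S(1) x(1) open_contains_cball by blast
    have "cball (f x) (s / 2) \<subseteq> f ` cball x s"
      using s by (intro surj_on_cball_if_near_identity lip) auto
    then show "\<exists>e>0. cball w e \<subseteq> f ` S"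
      using s x(2) by (intro exI[of _ "s / 2"]) auto
  qed
  define g where "g = inv_into S f"
  have gf: "g (f x) = x" if "x \<in> S" for x using inj that by (simp add: g_def)
  have gS: "g y \<in> S" "f (g y) = y" if "y \<in> f ` S" for y
    using that by (auto simp: g_def inv_into_into f_inv_into_f)
  have glip: "dist (g y) (g z) \<le> 2 * dist y z" if "y \<in> f ` S" "z \<in> f ` S" for y z
    using lower[of "g y" "g z"] gS that by (simp add: dist_norm)
  have contg: "continuous_on (f ` S) g"
    using glip by (intro lipschitz_on_continuous_on[of 2] lipschitz_onI) auto
  have "\<forall>x. \<exists>B. x \<in> S \<longrightarrow> f' x o\<^sub>L B = id_blinfun \<and> B o\<^sub>L f' x = id_blinfun \<and> norm B \<le> 2"
    using near inverse_near_identity by metis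
  then obtain B where B: "f' x o\<^sub>L B x = id_blinfun" "B x o\<^sub>L f' x = id_blinfun" "norm (B x) \<le> 2"
    if "x \<in> S" for x by metis
  \<comment> \<open>This rests on the resolvent identity
    \<open>B x - B y = B x (f' y - f' x) B y\<close>; the two outer factors have norm at most 2,
    whence the 4.\<close>
  have Blip: "norm (B x - B y) \<le> 4 * norm (f' x - f' y)" if "x \<in> S" "y \<in> S" for x y
  proof -
    have "B x (f' y (B y z)) = B x z" "B x (f' x (B y z)) = B y z" for z
      using arg_cong[OF B(1)[OF that(2)], of "\<lambda>T. blinfun_apply T z"]
        arg_cong[OF B(2)[OF that(1)], of "\<lambda>T. blinfun_apply T (B y z)"] by auto
    then have "B x - B y = B x o\<^sub>L ((f' y - f' x) o\<^sub>L B y)"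
      by (intro blinfun_eqI) (simp add: blinfun.bilinear_simps)
    also have "norm \<dots> \<le> norm (B x) * (norm (f' y - f' x) * norm (B y))"
      by (intro order_trans[OF norm_blinfun_compose] mult_left_mono norm_blinfun_compose) simp
    also have "\<dots> \<le> 2 * (norm (f' y - f' x) * 2)"
      using B(3) that by (intro mult_mono) auto
    finally show ?thesis by (simp add: norm_minus_commute)
  qed
  have contB: "continuous_on S B"
    unfolding continuous_on_def
  proof
    fix x assume x: "x \<in> S"
    have "((\<lambda>y. 4 * norm (f' y - f' x)) \<longlongrightarrow> 4 * norm (f' x - f' x)) (at x within S)"
      using fS x by (intro tendsto_intros) (auto simp: C1_on_def continuous_on_def)
    then have lim: "((\<lambda>y. 4 * norm (f' y - f' x)) \<longlongrightarrow> 0) (at x within S)" by simp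
    have "\<forall>\<^sub>F y in at x within S. y \<in> S" by (simp add: eventually_at_filter)
    then have "\<forall>\<^sub>F y in at x within S. norm (B y - B x) \<le> 4 * norm (f' y - f' x)"
      by (rule eventually_mono) (rule Blip[OF _ x])
    from Lim_null_comparison[OF this lim]
    show "(B \<longlongrightarrow> B x) (at x within S)" by (simp add: LIM_zero_iff)
  qed
  have "C1_on (f ` S) g (\<lambda>y. B (g y))"
    unfolding C1_on_def
  proof (intro conjI ballI)
    fix y assume y: "y \<in> f ` S"
    show "(g has_derivative blinfun_apply (B (g y))) (at y)"
    proof (rule has_derivative_inverse_basic[where f = f and T = "f ` S"])
      show "(f has_derivative blinfun_apply (f' (g y))) (at (g y))"
        using fS gS[OF y] by (simp add: C1_on_def)
      show "blinfun_apply (B (g y)) \<circ> blinfun_apply (f' (g y)) = id"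
        using B(2)[OF gS(1)[OF y]]
        by (metis blinfun_compose.rep_eq id_blinfun.rep_eq eq_id_iff)
      show "continuous (at y) g" using contg op y by (metis continuous_on_eq_continuous_at)
    qed (use op y gS in \<open>auto intro: blinfun.bounded_linear_right\<close>)
  next
    show "continuous_on (f ` S) (\<lambda>y. B (g y))"
      using contB contg gS by (intro continuous_on_compose2[OF contB contg]) auto
  qed
  then have "C1_diffeo_on S f" unfolding C1_diffeo_on_def using S(1) op fS gf by blast
  then show ?thesis using that S by blast
qed

section \<open>Generalized inverses and stability of the operator classes\<close>

lemma linear_blinfun: "linear (blinfun_apply A)"
  using blinfun.bounded_linear_right by (rule bounded_linear.linear)

text \<open>The graph of the algebraic generalized inverse is described by the two closed complements
  alone, so the closed graph theorem applies without a norm on the quotients.\<close>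

lemma bounded_generalized_inverse:
  fixes A :: "'a::banach \<Rightarrow>\<^sub>L 'b::banach"
  assumes "double_splitting A"
  obtains G :: "'b \<Rightarrow>\<^sub>L 'a" where "A o\<^sub>L G o\<^sub>L A = A" "G o\<^sub>L A o\<^sub>L G = G"
proof -
  obtain C D where C: "closed C" "alg_complement (null_space A) C"
    and D: "closed D" "alg_complement (range_space A) D"
    using assms unfolding double_splitting_def by blast
  have sub: "subspace C" "subspace D" and C0: "null_space A \<inter> C = {0}" and D0: "range_space A \<inter> D = {0}"
    and Cs: "{s + c | s c. s \<in> null_space A \<and> c \<in> C} = UNIV"
    and Ds: "{s + c | s c. s \<in> range_space A \<and> c \<in> D} = UNIV"
    using C(2) D(2) unfolding alg_complement_def by auto
  have "\<exists>e. e \<in> C \<and> y - A e \<in> D" for y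
  proof -
    have "y \<in> {s + c | s c. s \<in> range_space A \<and> c \<in> D}" using Ds by simp
    then obtain x d where y: "y = A x + d" "d \<in> D" by blast
    have "x \<in> {s + c | s c. s \<in> null_space A \<and> c \<in> C}" using Cs by simp
    then obtain n c where "x = n + c" "A n = 0" "c \<in> C" by blast
    then show ?thesis using y by (intro exI[of _ c]) (simp add: blinfun.add_right)
  qed
  then obtain L where L: "\<And>y. L y \<in> C" "\<And>y. y - A (L y) \<in> D" by metis
  \<comment> \<open>The two conditions determine \<open>L y\<close>: first the range of
    \<open>A\<close> meets \<open>D\<close> trivially, then the kernel meets \<open>C\<close>
    trivially. Linearity and the description of the graph both follow from this uniqueness.\<close>
  have uniq: "L y = e" if "e \<in> C" "y - A e \<in> D" for y e
  proof -
    have "(y - A e) - (y - A (L y)) \<in> D" using that L sub by (blast intro: subspace_diff)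
    then have "A (L y - e) \<in> D" by (simp add: blinfun.diff_right)
    then have "A (L y - e) \<in> range_space A \<inter> D" by blast
    then have "A (L y - e) = 0" unfolding D0 by simp
    moreover have "L y - e \<in> C" using that L sub by (blast intro: subspace_diff)
    ultimately have "L y - e \<in> null_space A \<inter> C" by blast
    then show ?thesis unfolding C0 by simp
  qed
  have lin: "linear L"
  proof (rule linearI)
    fix x y
    have "(x - A (L x)) + (y - A (L y)) \<in> D" using L sub subspace_add by blast
    then show "L (x + y) = L x + L y"
      by (intro uniq) (simp_all add: L sub subspace_add add_diff_add blinfun.add_right)
  next
    fix r x
    have "r *\<^sub>R (x - A (L x)) \<in> D" using L sub subspace_scale by blast
    then show "L (r *\<^sub>R x) = r *\<^sub>R L x"
      by (intro uniq) (simp_all add: L sub subspace_scale scaleR_diff_right blinfun.scaleR_right)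
  qed
  have graph: "{(y, L y) |y. True} = snd -` C \<inter> (\<lambda>p. fst p - A (snd p)) -` D"
    using L uniq by fastforce
  have "closed {(y, L y) |y. True}"
    unfolding graph using C(1) D(1)
    by (intro closed_Int continuous_closed_vimage) (auto intro!: continuous_intros)
  with lin have "bounded_linear L" by (rule closed_graph)
  then have GL: "blinfun_apply (Blinfun L) = L" by (rule bounded_linear_Blinfun_apply)
  have "A (L (A x)) = A x" for x
  proof -
    have "A (x - L (A x)) \<in> range_space A \<inter> D"
      using L(2)[of "A x"] rangeI[of "blinfun_apply A" "x - L (A x)"] by (simp add: blinfun.diff_right)
    then show ?thesis unfolding D0 by (simp add: blinfun.diff_right)
  qed
  moreover have "L (A (L y)) = L y" for y
    using L sub by (intro uniq) (auto simp: subspace_0)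
  ultimately show ?thesis
    using GL by (intro that[of "Blinfun L"] blinfun_eqI) simp_all
qed

section \<open>Transversality and invariance of the operator classes\<close>

lemma subspace_null_space: "subspace (null_space T)"
  by (rule linear_subspace_kernel) (rule linear_blinfun)

lemma subspace_range_space: "subspace (range_space T)"
  by (intro linear_subspace_image subspace_UNIV) (rule linear_blinfun)

text \<open>The maps \<open>1 + G (T - A)\<close> and \<open>1 + (T - A) G\<close> compare
  \<open>T\<close> with \<open>A\<close> through \<open>G\<close>. A nonzero vector in the
  intersection would make a finite rank, nullity or deficiency of \<open>T\<close> differ from that
  of \<open>A\<close>.\<close>

lemma range_Int_null_generalized_inverse:
  fixes A T :: "'a::real_normed_vector \<Rightarrow>\<^sub>L 'b::real_normed_vector" and G :: "'b \<Rightarrow>\<^sub>L 'a"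
  assumes AGA: "\<And>x. A (G (A x)) = A x" and GAG: "\<And>y. G (A (G y)) = G y"
    and bij: "bij (\<lambda>x. x + G (T x - A x))" and surj: "surj (\<lambda>y. y + (T (G y) - A (G y)))"
    and cls: "(\<exists>k. \<C> = rank_class k) \<or> (\<exists>m n. \<C> = Phi_class (enat m) (enat n))
       \<or> (\<exists>n. \<C> = Phi_class \<infinity> (enat n)) \<or> (\<exists>m. \<C> = Phi_class (enat m) \<infinity>)"
    and "A \<in> \<C>" "T \<in> \<C>"
  shows "range_space T \<inter> null_space G = {0}"
proof -
  let ?B = "\<lambda>x. x + G (T x - A x)"
  have linB: "linear ?B"
    by (intro linearI) (simp_all add: blinfun.bilinear_simps algebra_simps)
  have AB: "A (?B x) = A (G (T x))" for x
    by (simp add: blinfun.add_right blinfun.diff_right AGA)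
  have zero: "0 \<in> range_space T \<inter> null_space G"
    using blinfun.zero_right[of T] by (auto simp: blinfun.zero_right image_iff intro: exI[of _ 0])
  \<comment> \<open>Each Phi class is reduced to one of its finite indices, since the count needs a
    finite number.\<close>
  consider (rank) k where "\<C> = rank_class k"
    | (null) m where "\<C> \<subseteq> {T. edim (null_space T) = enat m}"
    | (codim) n where "\<C> \<subseteq> {T. ecodim (range_space T) = enat n}"
    using cls unfolding Phi_class_def by blast
  then have "y = 0" if y: "y \<in> range_space T" "G y = 0" for y
  proof cases
    case rank
    \<comment> \<open>By \<open>AB\<close>, \<open>?p\<close> maps the range of \<open>T\<close>
      onto that of \<open>A\<close>. Equal finite rank makes it injective there, while it
      annihilates \<open>null_space G\<close>.\<close>
    let ?p = "\<lambda>y. A (G y)"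
    have linp: "linear ?p" by (intro linearI) (simp_all add: blinfun.bilinear_simps)
    have "?p ` range_space T = blinfun_apply A ` range ?B" by (simp add: image_image AB)
    also have "\<dots> = range_space A" using bij_is_surj[OF bij] by simp
    finally have "inj_on ?p (range_space T)"
      using rank assms(6,7)
      by (intro inj_on_if_edim_image_eq[OF linp subspace_range_space, of _ k]) (auto simp: rank_class_def)
    then show ?thesis
      using y zero by (elim inj_onD) (auto simp: blinfun.zero_right)
  next
    case null
    \<comment> \<open>\<open>?B\<close> carries \<open>?N\<close> onto the kernel of
      \<open>A\<close>. As \<open>?N\<close> contains the kernel of \<open>T\<close> and both have
      dimension \<open>m\<close>, they coincide: \<open>G (T x) = 0\<close> forces
      \<open>T x = 0\<close>.\<close>
    let ?N = "{x. G (T x) = 0}"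
    have subN: "subspace ?N"
      by (intro linear_subspace_kernel linearI) (simp_all add: blinfun.bilinear_simps)
    have "?B ` ?N = null_space A"
    proof
      show "?B ` ?N \<subseteq> null_space A" using AB by (auto simp: blinfun.zero_right)
      show "null_space A \<subseteq> ?B ` ?N"
      proof
        fix n assume n: "n \<in> null_space A"
        obtain x where x: "n = ?B x" using bij_is_surj[OF bij] by (meson surjD)
        have "A (G (T x)) = 0" using n AB[of x] unfolding x by simp
        then have "G (T x) = 0" using GAG[of "T x"] by (simp add: blinfun.zero_right)
        then show "n \<in> ?B ` ?N" using x by blast
      qed
    qed
    then have "edim ?N = edim (null_space A)"
      using linB subN bij_is_inj[OF bij] by (intro edim_eq_if_linear_bij[of ?B]) (auto intro: inj_on_subset)
    then have "null_space T = ?N"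
      using null assms(6,7)
      by (intro subspace_eq_if_edim_eq[OF subspace_null_space subN]) (auto simp: blinfun.zero_right)
    then show ?thesis using y by blast
  next
    case codim
    let ?W = "range_space T \<inter> null_space G"
    have AG: "alg_complement (range_space A) (null_space G)"
    proof -
      have "y = 0" if "y \<in> range_space A" "G y = 0" for y
        using that AGA by (metis blinfun.zero_right imageE)
      moreover have "y \<in> {s + c | s c. s \<in> range_space A \<and> c \<in> null_space G}" for y
        unfolding mem_Collect_eq
        by (intro exI[of _ "A (G y)"] exI[of _ "y - A (G y)"]) (simp add: blinfun.diff_right GAG)
      ultimately show ?thesis
        unfolding alg_complement_def
        using subspace_range_space[of A] subspace_null_space[of G] subspace_0 by blast
    qed
    have "subspace ?W" by (intro subspace_inter subspace_range_space subspace_null_space)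
    \<comment> \<open>The part of \<open>null_space G\<close> in \<open>D\<close> will be a
      complement of the range of \<open>T\<close>, so its dimension equals that of
      \<open>null_space G\<close>. Thus \<open>null_space G\<close> lies in \<open>D\<close>, which
      meets \<open>?W\<close> trivially.\<close>
    then obtain D where D: "alg_complement ?W D" using alg_complement_exists by blast
    then have subD: "subspace D" and D0: "?W \<inter> D = {0}"
      and Ds: "{s + c | s c. s \<in> ?W \<and> c \<in> D} = UNIV" unfolding alg_complement_def by auto
    have TD: "alg_complement (range_space T) (D \<inter> null_space G)"
      unfolding alg_complement_def
    proof (intro conjI subspace_inter subspace_range_space subspace_null_space subD)
      show "range_space T \<inter> (D \<inter> null_space G) = {0}" using D0 by blast
      have "y \<in> {s + c | s c. s \<in> range_space T \<and> c \<in> D \<inter> null_space G}" for y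
      proof -
        obtain z where z: "y = z + (T (G z) - A (G z))" using surj by (meson surjD)
        have "z - A (G z) \<in> {s + c | s c. s \<in> ?W \<and> c \<in> D}" using Ds by simp
        then obtain u d where ud: "z - A (G z) = T u + d" "G (T u) = 0" "d \<in> D" by blast
        have "G (z - A (G z)) = 0" by (simp add: blinfun.diff_right GAG)
        then have "G d = 0" using ud(1,2) by (simp add: blinfun.add_right)
        \<comment> \<open>The second summand lies in \<open>null_space G\<close>; its component in
          \<open>?W\<close> is absorbed into the range of \<open>T\<close>, leaving
          \<open>d\<close>.\<close>
        moreover have "y = T (G z) + (z - A (G z))" using z by (simp add: algebra_simps)
        then have "y = T (G z + u) + d" unfolding ud(1) by (simp add: blinfun.add_right)
        ultimately show ?thesis using ud(3) by blast
      qed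
      then show "{s + c | s c. s \<in> range_space T \<and> c \<in> D \<inter> null_space G} = UNIV" by blast
    qed
    have "D \<inter> null_space G = null_space G"
      using codim assms(6,7) ecodim_eq[OF AG] ecodim_eq[OF TD]
      by (intro subspace_eq_if_edim_eq[OF _ subspace_null_space, of _ _ n] subspace_inter subD subspace_null_space) auto
    then have "y \<in> ?W \<inter> D" using y by blast
    then show ?thesis unfolding D0 by simp
  qed
  then show ?thesis using zero by blast
qed

text \<open>\<open>P'\<close> transports the kernel, and \<open>Q\<close> the range together with a
  complement of it. Closedness passes over because the new range is the preimage of the old one
  under \<open>Q'\<close>.\<close>

lemma operator_class_equivalent:
  fixes A :: "'a::real_normed_vector \<Rightarrow>\<^sub>L 'b::real_normed_vector"
  assumes P: "P o\<^sub>L P' = id_blinfun" "P' o\<^sub>L P = id_blinfun"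
    and Q: "Q o\<^sub>L Q' = id_blinfun" "Q' o\<^sub>L Q = id_blinfun"
    and cls: "(\<exists>k. \<C> = rank_class k) \<or> (\<exists>m n. \<C> = Phi_class m n)"
    and A: "A \<in> \<C>"
  shows "Q o\<^sub>L A o\<^sub>L P \<in> \<C>"
proof -
  let ?T = "Q o\<^sub>L A o\<^sub>L P"
  have PP: "P (P' x) = x" "P' (P x) = x" for x
    using P by (metis blinfun_apply_blinfun_compose blinfun_apply_id_blinfun)+
  have QQ: "Q (Q' x) = x" "Q' (Q x) = x" for x
    using Q by (metis blinfun_apply_blinfun_compose blinfun_apply_id_blinfun)+
  have linQ: "linear (blinfun_apply Q)" and linP': "linear (blinfun_apply P')"
    by (rule linear_blinfun)+
  have injQ: "inj_on (blinfun_apply Q) X" and injP': "inj_on (blinfun_apply P') Y" for X Y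
    by (metis inj_on_def QQ(2)) (metis inj_on_def PP(1))
  have "range (blinfun_apply P) = UNIV" using PP(1) by (rule surjI)
  moreover have "range_space ?T = blinfun_apply Q ` blinfun_apply A ` range (blinfun_apply P)"
    by (simp add: image_image)
  ultimately have rng: "range_space ?T = blinfun_apply Q ` range_space A" by simp
  have nul: "null_space ?T = blinfun_apply P' ` null_space A"
  proof
    show "null_space ?T \<subseteq> blinfun_apply P' ` null_space A"
    proof
      fix x assume "x \<in> null_space ?T"
      then have "Q' (Q (A (P x))) = 0" by (simp add: blinfun.zero_right)
      then show "x \<in> blinfun_apply P' ` null_space A" unfolding QQ
        by (intro image_eqI[of _ _ "P x"]) (simp_all add: PP)
    qed
  qed (auto simp: PP blinfun.zero_right)
  have er: "edim (range_space ?T) = edim (range_space A)"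
    unfolding rng by (rule edim_eq_if_linear_bij[OF linQ injQ refl subspace_range_space, symmetric])
  have en: "edim (null_space ?T) = edim (null_space A)"
    unfolding nul by (rule edim_eq_if_linear_bij[OF linP' injP' refl subspace_null_space, symmetric])
  have "closed (range_space ?T)" if "closed (range_space A)"
  proof -
    have "range_space ?T = blinfun_apply Q' -` range_space A"
      unfolding rng using QQ by (auto simp: image_iff) metis
    then show ?thesis
      using that by (simp add: continuous_closed_vimage linear_continuous_at blinfun.bounded_linear_right)
  qed
  moreover have ec: "ecodim (range_space ?T) = ecodim (range_space A)"
  proof -
    obtain D where D: "alg_complement (range_space A) D"
      using alg_complement_exists subspace_range_space by blast
    then have subD: "subspace D" and D0: "range_space A \<inter> D = {0}"
      and Ds: "{s + c | s c. s \<in> range_space A \<and> c \<in> D} = UNIV" unfolding alg_complement_def by auto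
    have "alg_complement (range_space ?T) (blinfun_apply Q ` D)"
      unfolding alg_complement_def
    proof (intro conjI subspace_range_space linear_subspace_image linQ subD)
      have "range_space ?T \<inter> blinfun_apply Q ` D = blinfun_apply Q ` (range_space A \<inter> D)"
        unfolding rng by (rule image_Int[symmetric]) (rule injQ)
      then show "range_space ?T \<inter> blinfun_apply Q ` D = {0}" unfolding D0 by (simp add: blinfun.zero_right)
      have "y \<in> {s + c | s c. s \<in> range_space ?T \<and> c \<in> blinfun_apply Q ` D}" for y
      proof -
        have "Q' y \<in> {s + c | s c. s \<in> range_space A \<and> c \<in> D}" using Ds by simp
        then obtain s c where sc: "Q' y = s + c" "s \<in> range_space A" "c \<in> D" by blast
        have "y = Q s + Q c" using QQ(1)[of y] sc(1) by (simp add: blinfun.add_right)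
        then show ?thesis using sc(2,3) unfolding rng by blast
      qed
      then show "{s + c | s c. s \<in> range_space ?T \<and> c \<in> blinfun_apply Q ` D} = UNIV" by blast
    qed
    then have "ecodim (range_space ?T) = edim (blinfun_apply Q ` D)" by (rule ecodim_eq)
    also have "\<dots> = edim D" by (rule edim_eq_if_linear_bij[OF linQ injQ refl subD, symmetric])
    also have "\<dots> = ecodim (range_space A)" using ecodim_eq[OF D] by simp
    finally show ?thesis .
  qed
  ultimately show ?thesis
    using A cls er en unfolding rank_class_def Phi_class_def semi_Fredholm_def by auto
qed

section \<open>Local conjugacy\<close>

text \<open>Differentiating both compositions of \<open>f\<close> with its inverse, each the
  identity on an open set, shows that the derivative of the inverse is a two-sided inverse
  operator.\<close>

lemma C1_diffeo_on_derivative_inverse: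
  assumes "C1_diffeo_on S f" and "C1_on S f f'" and x: "x \<in> S"
  obtains B where "f' x o\<^sub>L B = id_blinfun" "B o\<^sub>L f' x = id_blinfun"
proof -
  obtain g g' where op: "open S" "open (f ` S)"
    and gf: "\<And>x. x \<in> S \<Longrightarrow> g (f x) = x" and g: "C1_on (f ` S) g g'"
    using assms(1) unfolding C1_diffeo_on_def by blast
  have df: "(f has_derivative f' x) (at x)" using assms(2) x by (simp add: C1_on_def)
  have dg: "(g has_derivative g' (f x)) (at (f x))" using g x by (simp add: C1_on_def)
  have "(g \<circ> f has_derivative g' (f x) \<circ> f' x) (at x)" using df dg by (rule diff_chain_at)
  then have "((\<lambda>x. x) has_derivative g' (f x) \<circ> f' x) (at x)"
    by (rule has_derivative_transform_within_open[OF _ op(1) x]) (use gf in simp)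
  then have 1: "g' (f x) \<circ> f' x = (\<lambda>x. x)" using has_derivative_ident by (rule has_derivative_unique)
  have "(f \<circ> g has_derivative f' x \<circ> g' (f x)) (at (f x))"
    using diff_chain_at[OF dg, of f "f' x"] df gf[OF x] by simp
  then have "((\<lambda>x. x) has_derivative f' x \<circ> g' (f x)) (at (f x))"
    by (rule has_derivative_transform_within_open[OF _ op(2)]) (use x gf in auto)
  then have 2: "f' x \<circ> g' (f x) = (\<lambda>x. x)" using has_derivative_ident by (rule has_derivative_unique)
  show ?thesis
    using fun_cong[OF 1] fun_cong[OF 2]
    by (intro that[of "g' (f x)"]) (auto intro!: blinfun_eqI)
qed

lemma C1_on_shear:
  assumes "C1_on S h h'"
  shows "C1_on (blinfun_apply G -` S) (\<lambda>z. c + z + h (G z)) (\<lambda>z. id_blinfun + (h' (G z) o\<^sub>L G))"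
proof -
  have "C1_on (blinfun_apply G -` S) (\<lambda>z. h (G z)) (\<lambda>z. h' (G z) o\<^sub>L G)"
    by (rule C1_on_compose[OF C1_on_blinfun assms]) blast
  from C1_on_add[OF C1_on_add[OF C1_on_const C1_on_ident] this] show ?thesis by simp
qed

text \<open>Since \<open>h\<close> takes values in the kernel of \<open>G\<close>, the shear does
  not change \<open>G z\<close> apart from the translation by \<open>c\<close>. The correction can
  therefore be recomputed from the image point and subtracted, which gives an explicit
  inverse.\<close>

lemma C1_diffeo_on_shear:
  fixes G :: "'b::real_normed_vector \<Rightarrow>\<^sub>L 'a::real_normed_vector"
  assumes "open S" and h: "C1_on S h h'" and Gh: "\<And>x. x \<in> S \<Longrightarrow> G (h x) = 0"
  shows "C1_diffeo_on (blinfun_apply G -` S) (\<lambda>z. c + z + h (G z))"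
proof -
  let ?V = "blinfun_apply G -` S" and ?\<psi> = "\<lambda>z. c + z + h (G z)"
  have opV: "open ?V"
    using \<open>open S\<close> by (simp add: continuous_open_vimage linear_continuous_at blinfun.bounded_linear_right)
  have im: "?\<psi> ` ?V = {w. G (w - c) \<in> S}"
  proof
    show "?\<psi> ` ?V \<subseteq> {w. G (w - c) \<in> S}" using Gh by (auto simp: blinfun.add_right)
    show "{w. G (w - c) \<in> S} \<subseteq> ?\<psi> ` ?V"
    proof
      fix w assume "w \<in> {w. G (w - c) \<in> S}"
      then have w: "G (w - c) \<in> S" by simp
      let ?z = "w - c - h (G (w - c))"
      have "G ?z = G (w - c)" using Gh[OF w] by (simp add: blinfun.diff_right)
      then show "w \<in> ?\<psi> ` ?V" using w by (intro image_eqI[of _ _ ?z]) simp_all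
    qed
  qed
  have c1: "C1_on X (\<lambda>w. w - c) (\<lambda>_. id_blinfun)" for X :: "'b set"
    using C1_on_diff[OF C1_on_ident C1_on_const, of X c] by simp
  have opI: "open (?\<psi> ` ?V)"
  proof -
    have "?\<psi> ` ?V = (\<lambda>w. w - c) -` ?V" unfolding im by auto
    moreover have "open ((\<lambda>w. w - c) -` ?V)"
      using opV by (rule continuous_open_vimage) simp
    ultimately show ?thesis by simp
  qed
  have "C1_on (?\<psi> ` ?V) (\<lambda>w. G (w - c)) (\<lambda>_. G o\<^sub>L id_blinfun)"
    using c1 by (rule C1_on_linear_compose)
  then have "C1_on (?\<psi> ` ?V) (\<lambda>w. h (G (w - c))) (\<lambda>w. h' (G (w - c)) o\<^sub>L (G o\<^sub>L id_blinfun))"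
    by (rule C1_on_compose[OF _ h]) (auto simp: im)
  with c1 have "C1_on (?\<psi> ` ?V) (\<lambda>w. w - c - h (G (w - c)))
      (\<lambda>w. id_blinfun - (h' (G (w - c)) o\<^sub>L (G o\<^sub>L id_blinfun)))"
    by (rule C1_on_diff)
  moreover have "\<forall>z\<in>?V. ?\<psi> z - c - h (G (?\<psi> z - c)) = z"
    using Gh by (simp add: blinfun.add_right)
  ultimately have "\<exists>g g'. (\<forall>z\<in>?V. g (?\<psi> z) = z) \<and> C1_on (?\<psi> ` ?V) g g'"
    by (intro exI[of _ "\<lambda>w. w - c - h (G (w - c))"] exI conjI)
  then show ?thesis
    unfolding C1_diffeo_on_def using opV opI C1_on_shear[OF h, of G c] by blast
qed

lemma locally_conjugate_if_transversal:
  fixes f :: "'a::banach \<Rightarrow> 'b::banach" and G :: "'b \<Rightarrow>\<^sub>L 'a"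
  assumes W: "open W" "a \<in> W" and f: "C1_on W f f'"
    and AGA: "\<And>x. f' a (G (f' a x)) = f' a x" and GAG: "\<And>y. G (f' a (G y)) = G y"
    and transversal: "\<And>x. x \<in> W \<Longrightarrow> range_space (f' x) \<inter> null_space G = {0}"
  shows "locally_conjugate W f a (f' a)"
proof -
  define A where "A = f' a"
  note AGA = AGA[folded A_def] and GAG = GAG[folded A_def]
  define \<phi> where "\<phi> x = G (f x - f a) + ((x - a) - G (A (x - a)))" for x
  \<comment> \<open>The zeros are the derivatives of the constants \<open>f a\<close> and
    \<open>a\<close>, kept so that the rules for \<open>C1_on\<close> apply literally.\<close>
  define \<phi>' where "\<phi>' x = (G o\<^sub>L (f' x - 0)) + ((id_blinfun - 0) - (G o\<^sub>L (A o\<^sub>L (id_blinfun - 0))))" for x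
  have \<phi>: "C1_on W \<phi> \<phi>'"
    unfolding \<phi>_def \<phi>'_def
    by (intro C1_on_add C1_on_diff C1_on_linear_compose C1_on_const C1_on_ident f)
  have \<phi>a: "\<phi> a = 0" by (simp add: \<phi>_def blinfun.zero_right)
  have \<phi>'a: "\<phi>' a = id_blinfun"
    by (intro blinfun_eqI) (simp add: \<phi>'_def A_def blinfun.bilinear_simps)
  obtain S where S: "open S" "a \<in> S" "S \<subseteq> W" "C1_diffeo_on S \<phi>"
    using C1_diffeo_at_identity_derivative[OF W \<phi> \<phi>'a] .
  then obtain g g' where op: "open (\<phi> ` S)"
    and g\<phi>: "\<And>x. x \<in> S \<Longrightarrow> g (\<phi> x) = x" and g: "C1_on (\<phi> ` S) g g'"
    unfolding C1_diffeo_on_def by blast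
  have \<phi>g: "\<phi> (g y) = y" and gS: "g y \<in> S" if "y \<in> \<phi> ` S" for y
    using that g\<phi> by auto
  have "0 \<in> \<phi> ` S" using S(2) \<phi>a by force
  then obtain r where r: "r > 0" "ball 0 r \<subseteq> \<phi> ` S" using op openE by blast
  define F F' where "F y = f (g y) - f a" and "F' y = (f' (g y) o\<^sub>L g' y) - 0" for y
  have F: "C1_on (ball 0 r) F F'"
    unfolding F_def F'_def
    by (intro C1_on_diff C1_on_const C1_on_compose[where T = W] f C1_on_subset[OF g r(2)])
      (use gS r(2) S(3) in blast)
  have A\<phi>: "A (\<phi> x) = A (G (f x - f a))" for x
    by (simp add: \<phi>_def blinfun.add_right blinfun.diff_right AGA)
  \<comment> \<open>In the coordinates given by \<open>\<phi>\<close>, the component of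
    \<open>F\<close> in the range of \<open>A\<close> is exactly linear.\<close>
  have AGF: "A (G (F y)) = A y" if "y \<in> ball 0 r" for y
    using A\<phi>[of "g y"] \<phi>g[of y] r(2) that by (auto simp: F_def)
  have AGF': "A (G (F' y v)) = A v" if y: "y \<in> ball 0 r" for y v
  proof -
    have "C1_on (ball 0 r) (\<lambda>y. A (G (F y))) (\<lambda>y. A o\<^sub>L (G o\<^sub>L F' y))"
      by (intro C1_on_linear_compose F)
    then have "((\<lambda>y. A (G (F y))) has_derivative blinfun_apply (A o\<^sub>L (G o\<^sub>L F' y))) (at y)"
      using y by (simp add: C1_on_def)
    then have "(blinfun_apply A has_derivative blinfun_apply (A o\<^sub>L (G o\<^sub>L F' y))) (at y)"
      by (rule has_derivative_transform_within_open[OF _ open_ball y AGF])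
    then have "blinfun_apply (A o\<^sub>L (G o\<^sub>L F' y)) = blinfun_apply A"
      using C1_on_blinfun[of UNIV A] by (auto simp: C1_on_def intro: has_derivative_unique)
    then show ?thesis by (metis blinfun_apply_blinfun_compose)
  qed
  \<comment> \<open>For \<open>n\<close> in the kernel of \<open>A\<close>, \<open>AGF'\<close> and
    \<open>GAG\<close> put \<open>F' y n\<close> into \<open>null_space G\<close>; it also lies in
    the range of \<open>f' (g y)\<close>, so transversality annihilates it.\<close>
  have F'0: "F' y n = 0" if y: "y \<in> ball 0 r" and n: "A n = 0" for y n
  proof -
    have "G (F' y n) = 0"
      using GAG[of "F' y n"] AGF'[OF y, of n] n by (simp add: blinfun.zero_right)
    moreover have "F' y n = f' (g y) (g' y n)" by (simp add: F'_def)
    moreover have "g y \<in> W" using y gS r(2) S(3) by blast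
    ultimately show ?thesis using transversal[of "g y"] by auto
  qed
  have Fconst: "F (G (A y)) = F y" if y: "y \<in> ball 0 r" and Py: "G (A y) \<in> ball 0 r" for y
  proof -
    \<comment> \<open>The segment from \<open>y\<close> to \<open>G (A y)\<close> stays in the
      convex ball and runs in a direction of the kernel of \<open>A\<close>, along which
      \<open>F\<close> has derivative zero.\<close>
    define n where "n = G (A y) - y"
    define p where "p t = y + t *\<^sub>R n" for t :: real
    have An: "A n = 0" by (simp add: n_def blinfun.diff_right AGA)
    have p: "p t \<in> ball 0 r" if "t \<in> {0..1}" for t
    proof -
      have "p t = (1 - t) *\<^sub>R y + t *\<^sub>R G (A y)" by (simp add: p_def n_def algebra_simps)
      then show ?thesis using convexD_alt[OF convex_ball y Py, of t] that by simp
    qed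
    have "((\<lambda>t. F (p t)) has_derivative (\<lambda>h. 0)) (at t within {0..1})" if "t \<in> {0..1}" for t
    proof -
      have "(p has_derivative (\<lambda>h. h *\<^sub>R n)) (at t)"
        unfolding p_def by (auto intro!: derivative_eq_intros)
      moreover have "(F has_derivative F' (p t)) (at (p t))" using F p[OF that] by (simp add: C1_on_def)
      ultimately have "(F \<circ> p has_derivative F' (p t) \<circ> (\<lambda>h. h *\<^sub>R n)) (at t)" by (rule diff_chain_at)
      then show ?thesis
        using F'0[OF p[OF that] An] by (auto simp: o_def blinfun.scaleR_right intro: has_derivative_at_withinI)
    qed
    then have "F (p 1) = F (p 0)"
      by (intro has_derivative_zero_unique[of "{0..1}" "\<lambda>t. F (p t)"]) auto
    then show ?thesis by (simp add: p_def n_def)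
  qed
  define h h' where "h y = F y - A (G (F y))" and "h' y = F' y - (A o\<^sub>L (G o\<^sub>L F' y))" for y
  have h: "C1_on (ball 0 r) h h'"
    unfolding h_def h'_def by (intro C1_on_diff C1_on_linear_compose F)
  have Gh: "G (h y) = 0" for y by (simp add: h_def blinfun.diff_right GAG)
  define \<psi> where "\<psi> z = f a + z + h (G z)" for z
  define V\<^sub>0 where "V\<^sub>0 = blinfun_apply G -` ball 0 r"
  \<comment> \<open>Both endpoints of the segment in \<open>Fconst\<close> must lie in the ball; the
    condition on \<open>G (A (\<phi> x))\<close> also places \<open>A (\<phi> x)\<close> in
    \<open>V\<^sub>0\<close>.\<close>
  define U\<^sub>0 where "U\<^sub>0 = {x \<in> S. \<phi> x \<in> ball 0 r \<and> G (A (\<phi> x)) \<in> ball 0 r}"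
  have cont\<phi>: "continuous_on S \<phi>"
    using C1_on_imp_continuous_on[OF \<phi>] S(3) by (rule continuous_on_subset)
  have "U\<^sub>0 = (S \<inter> \<phi> -` ball 0 r) \<inter> (S \<inter> (\<lambda>x. G (A (\<phi> x))) -` ball 0 r)"
    by (auto simp: U\<^sub>0_def)
  moreover have "open \<dots>"
    using S(1) cont\<phi>
    by (intro open_Int continuous_open_preimage) (auto intro!: continuous_intros)
  ultimately have opU: "open U\<^sub>0" by simp
  have aU: "a \<in> U\<^sub>0" using S(2) r(1) by (simp add: U\<^sub>0_def \<phi>a blinfun.zero_right)
  have d\<phi>: "C1_diffeo_on U\<^sub>0 \<phi>"
    using S(4) opU by (rule C1_diffeo_on_subset) (auto simp: U\<^sub>0_def)
  have d\<phi>a: "(\<phi> has_derivative (\<lambda>h. h)) (at a)"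
  proof -
    have "(\<phi> has_derivative \<phi>' a) (at a)" using \<phi> W by (simp add: C1_on_def)
    then show ?thesis by (simp add: \<phi>'a id_blinfun.rep_eq)
  qed
  have d\<psi>: "C1_diffeo_on V\<^sub>0 \<psi>"
    unfolding V\<^sub>0_def \<psi>_def using open_ball h Gh by (rule C1_diffeo_on_shear)
  have g0: "g 0 = a" using g\<phi>[OF S(2)] \<phi>a by simp
  have \<psi>0: "\<psi> 0 = f a" by (simp add: \<psi>_def h_def F_def g0 blinfun.zero_right)
  have d\<psi>0: "(\<psi> has_derivative (\<lambda>h. h)) (at 0)"
  proof -
    \<comment> \<open>As \<open>g 0 = a\<close>, \<open>F' 0\<close> is \<open>A\<close> composed
      with \<open>g' 0\<close>. Its values lie in the range of \<open>A\<close>, where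
      \<open>1 - A G\<close> vanishes.\<close>
    have "h' 0 = 0"
      by (intro blinfun_eqI) (simp add: h'_def F'_def g0 A_def[symmetric] blinfun.bilinear_simps AGA)
    moreover have "(\<psi> has_derivative (id_blinfun + (h' (G 0) o\<^sub>L G))) (at 0)"
      using C1_on_shear[OF h, of G "f a"] r(1)
      unfolding \<psi>_def by (auto simp: C1_on_def blinfun.zero_right dest!: bspec[of _ _ 0])
    ultimately show ?thesis by (simp add: blinfun.zero_right id_blinfun.rep_eq)
  qed
  have conj: "A (\<phi> x) \<in> V\<^sub>0 \<and> f x = \<psi> (A (\<phi> x))" if "x \<in> U\<^sub>0" for x
  proof -
    have x: "x \<in> S" "\<phi> x \<in> ball 0 r" "G (A (\<phi> x)) \<in> ball 0 r" using that by (auto simp: U\<^sub>0_def)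
    have "F (\<phi> x) = f x - f a" using x(1) by (simp add: F_def g\<phi>)
    \<comment> \<open>By \<open>Fconst\<close>, \<open>h (G (A (\<phi> x)))\<close> equals
      \<open>f x - f a - A (\<phi> x)\<close>, so the sum defining \<open>\<psi>\<close>
      telescopes.\<close>
    then have "\<psi> (A (\<phi> x)) = f x"
      using Fconst[OF x(2,3)] A\<phi>[of x] by (simp add: \<psi>_def h_def)
    then show ?thesis using x(3) by (simp add: V\<^sub>0_def)
  qed
  have "U\<^sub>0 \<subseteq> W" "0 \<in> V\<^sub>0" using S(3) r(1) by (auto simp: U\<^sub>0_def V\<^sub>0_def blinfun.zero_right)
  then show ?thesis
    unfolding locally_conjugate_def A_def[symmetric]
    using aU d\<phi> \<phi>a d\<phi>a d\<psi> \<psi>0 d\<psi>0 conj by blast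
qed

section \<open>Local conjugacy and local constancy of the class\<close>

theorem theorem1p9:
  fixes f :: "'a::banach \<Rightarrow> 'b::banach"
    and f' :: "'a \<Rightarrow> 'a \<Rightarrow>\<^sub>L 'b"
    and U :: "'a set" and x\<^sub>0 :: 'a
    and \<C> :: "('a \<Rightarrow>\<^sub>L 'b) set"
  assumes "open U" and "C1_on U f f'" and "x\<^sub>0 \<in> U"
    and "double_splitting (f' x\<^sub>0)"
    and "(\<exists>k. \<C> = rank_class k)
       \<or> (\<exists>m n. \<C> = Phi_class (enat m) (enat n))
       \<or> (\<exists>n. \<C> = Phi_class \<infinity> (enat n))
       \<or> (\<exists>m. \<C> = Phi_class (enat m) \<infinity>)"
    and "f' x\<^sub>0 \<in> \<C>"
  shows "locally_conjugate U f x\<^sub>0 (f' x\<^sub>0) \<longleftrightarrow>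
    (\<exists>W. open W \<and> x\<^sub>0 \<in> W \<and> W \<subseteq> U \<and> (\<forall>x\<in>W. f' x \<in> \<C>))"
proof
  assume "locally_conjugate U f x\<^sub>0 (f' x\<^sub>0)"
  then obtain U\<^sub>0 V\<^sub>0 \<phi> \<psi> where U\<^sub>0: "U\<^sub>0 \<subseteq> U" "x\<^sub>0 \<in> U\<^sub>0"
    and \<phi>: "C1_diffeo_on U\<^sub>0 \<phi>" and \<psi>: "C1_diffeo_on V\<^sub>0 \<psi>"
    and conj: "\<forall>x\<in>U\<^sub>0. f' x\<^sub>0 (\<phi> x) \<in> V\<^sub>0 \<and> f x = \<psi> (f' x\<^sub>0 (\<phi> x))"
    unfolding locally_conjugate_def by blast
  obtain \<phi>' where \<phi>': "C1_on U\<^sub>0 \<phi> \<phi>'" using \<phi> unfolding C1_diffeo_on_def by blast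
  obtain \<psi>' where \<psi>': "C1_on V\<^sub>0 \<psi> \<psi>'" using \<psi> unfolding C1_diffeo_on_def by blast
  have opU: "open U\<^sub>0" using \<phi> unfolding C1_diffeo_on_def by blast
  have "f' x \<in> \<C>" if x: "x \<in> U\<^sub>0" for x
  proof -
    let ?z = "f' x\<^sub>0 (\<phi> x)"
    have z: "?z \<in> V\<^sub>0" using conj x by blast
    have "C1_on U\<^sub>0 (\<lambda>x. \<psi> (f' x\<^sub>0 (\<phi> x))) (\<lambda>x. \<psi>' (f' x\<^sub>0 (\<phi> x)) o\<^sub>L (f' x\<^sub>0 o\<^sub>L \<phi>' x))"
      using conj by (intro C1_on_compose[OF C1_on_linear_compose[OF \<phi>'] \<psi>']) auto
    then have "((\<lambda>x. \<psi> (f' x\<^sub>0 (\<phi> x))) has_derivative (\<psi>' ?z o\<^sub>L (f' x\<^sub>0 o\<^sub>L \<phi>' x))) (at x)"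
      using x by (simp add: C1_on_def)
    then have "(f has_derivative (\<psi>' ?z o\<^sub>L (f' x\<^sub>0 o\<^sub>L \<phi>' x))) (at x)"
      by (rule has_derivative_transform_within_open[OF _ opU x]) (use conj in simp)
    moreover have "(f has_derivative f' x) (at x)" using assms(2) U\<^sub>0(1) x by (auto simp: C1_on_def)
    ultimately have "blinfun_apply (f' x) = blinfun_apply (\<psi>' ?z o\<^sub>L (f' x\<^sub>0 o\<^sub>L \<phi>' x))"
      by (rule has_derivative_unique[rotated])
    then have eq: "f' x = \<psi>' ?z o\<^sub>L f' x\<^sub>0 o\<^sub>L \<phi>' x" by (intro blinfun_eqI) simp
    obtain P where P: "\<phi>' x o\<^sub>L P = id_blinfun" "P o\<^sub>L \<phi>' x = id_blinfun"
      using C1_diffeo_on_derivative_inverse[OF \<phi> \<phi>' x] .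
    obtain Q where Q: "\<psi>' ?z o\<^sub>L Q = id_blinfun" "Q o\<^sub>L \<psi>' ?z = id_blinfun"
      using C1_diffeo_on_derivative_inverse[OF \<psi> \<psi>' z] .
    show ?thesis
      unfolding eq by (rule operator_class_equivalent[OF P Q _ assms(6)]) (use assms(5) in blast)
  qed
  then show "\<exists>W. open W \<and> x\<^sub>0 \<in> W \<and> W \<subseteq> U \<and> (\<forall>x\<in>W. f' x \<in> \<C>)" using opU U\<^sub>0 by blast
next
  assume "\<exists>W. open W \<and> x\<^sub>0 \<in> W \<and> W \<subseteq> U \<and> (\<forall>x\<in>W. f' x \<in> \<C>)"
  then obtain W where W: "open W" "x\<^sub>0 \<in> W" "W \<subseteq> U" and cls: "\<And>x. x \<in> W \<Longrightarrow> f' x \<in> \<C>" by blast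
  define A where "A = f' x\<^sub>0"
  obtain G where "A o\<^sub>L G o\<^sub>L A = A" "G o\<^sub>L A o\<^sub>L G = G"
    using bounded_generalized_inverse[OF assms(4)] unfolding A_def .
  then have AGA: "A (G (A x)) = A x" and GAG: "G (A (G y)) = G y" for x y
    by (metis blinfun_apply_blinfun_compose)+
  define dB where "dB x = G o\<^sub>L (f' x - A)" for x
  define dC where "dC x = (f' x - A) o\<^sub>L G" for x
  \<comment> \<open>The bound 1/2 makes \<open>1 + dB x\<close> and \<open>1 + dC x\<close>
    invertible, which supplies the bijectivity and surjectivity used for transversality.\<close>
  define W' where "W' = (W \<inter> dB -` ball 0 (1/2)) \<inter> (W \<inter> dC -` ball 0 (1/2))"
  have contf': "continuous_on W f'"
    using assms(2) W(3) by (auto simp: C1_on_def intro: continuous_on_subset)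
  have "open W'"
    unfolding W'_def dB_def dC_def using W(1) contf'
    by (intro open_Int continuous_open_preimage)
      (auto intro!: continuous_intros bounded_bilinear.continuous_on[OF bounded_bilinear_blinfun_compose])
  moreover have "x\<^sub>0 \<in> W'" using W(2) by (simp add: W'_def dB_def dC_def A_def)
  moreover have "W' \<subseteq> U" using W(3) by (auto simp: W'_def)
  then have "C1_on W' f f'" by (rule C1_on_subset[OF assms(2)])
  moreover have "range_space (f' x) \<inter> null_space G = {0}" if x: "x \<in> W'" for x
  proof (rule range_Int_null_generalized_inverse[OF AGA GAG])
    have n: "norm (dB x) \<le> 1/2" "norm (dC x) \<le> 1/2" using x by (auto simp: W'_def)
    have "norm ((id_blinfun + dB x) - id_blinfun) \<le> 1/2" using n by simp
    then obtain B where B: "(id_blinfun + dB x) o\<^sub>L B = id_blinfun" "B o\<^sub>L (id_blinfun + dB x) = id_blinfun"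
      by (rule inverse_near_identity)
    have [simp]: "blinfun_apply (id_blinfun + dB x) = (\<lambda>y. y + G (f' x y - A y))"
      by (auto simp: dB_def blinfun.bilinear_simps)
    show "bij (\<lambda>y. y + G (f' x y - A y))"
      using blinfun_bij_if_inverse[OF B] by simp
    have "norm ((id_blinfun + dC x) - id_blinfun) \<le> 1/2" using n by simp
    then obtain C where C: "(id_blinfun + dC x) o\<^sub>L C = id_blinfun" "C o\<^sub>L (id_blinfun + dC x) = id_blinfun"
      by (rule inverse_near_identity)
    have [simp]: "blinfun_apply (id_blinfun + dC x) = (\<lambda>y. y + (f' x (G y) - A (G y)))"
      by (auto simp: dC_def blinfun.bilinear_simps)
    show "surj (\<lambda>y. y + (f' x (G y) - A (G y)))"
      using bij_is_surj[OF blinfun_bij_if_inverse[OF C]] by simp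
    show "f' x \<in> \<C>" using cls x by (auto simp: W'_def)
  qed (use assms(5,6) A_def in auto)
  ultimately have "locally_conjugate W' f x\<^sub>0 (f' x\<^sub>0)"
    using AGA GAG unfolding A_def by (intro locally_conjugate_if_transversal) auto
  then show "locally_conjugate U f x\<^sub>0 (f' x\<^sub>0)"
    unfolding locally_conjugate_def using \<open>W' \<subseteq> U\<close> by (meson subset_trans)
qed

end
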